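(* Let $p\ge 5$ be an odd integer and let $P=(h_0,h_1,\dots,h_{p-1})$ be a petal permutation (a permutation of $\{1,\dots,p\}$) describing a given knot in terms of a $p$-petal projection. Let $C=(c_0,\dots,c_{p(p-3)-1})$ be the petal unsigned Gauss code for petal number $p$. Then a signed Gauss code corresponding to $P$ (that is, a signed Gauss code of the split petal projection with petal permutation $P$) is given by the sequence $C'=(c'_0,\dots,c'_{p(p-3)-1})$, where for each $k\in\{0,\dots,p(p-3)-1\}$ $$c'_k=\begin{cases} c_k & \text{if } h_{b(k)}<h_{b'(k)},\\ -c_k & \text{otherwise.}\end{cases}$$
   Context: Petal projections. A petal projection is a knot projection with a single crossing, through which many strands pass, and with no nested loops (the loops around the crossing are the petals). If $p$ strands pass through the crossing ($p$ is the petal number, which is odd for a knot), each is assigned a height in $\{1,\dots,p\}$, with $1$ the topmost strand and $p$ the bottom strand. The petal permutation $P=(h_0,\dots,h_{p-1})$ lists the heights of the strands in the order in which they are met when travelling along the knot. Split petal projections. The split petal projection with petal permutation $P$ is the redrawing of the petal projection as an ordinary knot diagram having only double crossings, the same rotational symmetry, and no reducible crossings (in its projection): the strands are perturbed symmetrically off the central point and all the resulting loops are untwisted. Concretely, with $m=\frac{p-1}{2}$ and $v_0,\dots,v_{p-1}$ (indices mod $p$) the vertices of a regular $p$-gon in cyclic order, its projection is the closed curve (the star polygon $\{p/m\}$, whose corners are not crossings) that traverses successively the straight strands $s_0,s_1,\dots,s_{p-1}$, where $s_j$ runs from $v_{mj}$ to $v_{m(j+1)}$. Strand $s_j$ has height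 $h_j$, and wherever two strands cross, the one with the smaller height number passes over the other. Gauss codes. Number the crossings of a knot diagram $1,\dots,N$ in any order, choose a starting point (not a crossing) and a direction, and travel once around the knot. Recording the number of each crossing passed gives an unsigned Gauss code (of length $2N$). Recording the number when the crossing is passed over, and its negative when it is passed under, gives a signed Gauss code. The petal unsigned Gauss code. Let $r_n(k)$ be the smallest non-negative integer congruent to $k$ mod $n$. All sequences are indexed from $0$. The sequence $L_0,L_1,\dots$ is periodic with period $p-3$, one period being $0,1,2,\dots,\frac{p-5}{2},\frac{p-5}{2},\dots,2,1,0$. The sequence $a_0,a_1,\dots$ is periodic with period $p-3$, one period being $\underbrace{0,\dots,0}_{(p-3)/2},1,2,\dots,\frac{p-3}{2}$. Put $$n_k=r_p\left(\frac{p-1}{2}\left\lfloor\frac{k}{p-3}\right\rfloor+a_k\right)+1,\qquad c_k=p\cdot L_k+n_k .$$ The petal unsigned Gauss code for petal number $p$ is $(c_0,\dots,c_{p(p-3)-1})$. Petal blocks. For an index $k\in\{0,\dots,p(p-3)-1\}$ set $$d(k)=\begin{cases} p-3-2r_{p-3}(k) & \text{if } r_{p-3}(k)<\frac{p-3}{2},\\ p-5-2r_{p-3}(k) & \text{otherwise,}\end{cases}$$ $$b(k)=\left\lfloor\frac{k}{p-3}\right\rfloor,\qquad b'(k)=r_p\left(\left\lfloor\frac{k}{p-3}\right\rfloor+d(k)\right).$$ *)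

theory Defs
  imports "HOL-Analysis.Analysis"
begin

text \<open>
  A knot diagram is given by a closed plane curve \<open>\<gamma>\<close>, parametrised over the whole real line with
  period \<open>T\<close>, whose only multiple points are double points, together with a function \<open>dep\<close> that
  assigns to each parameter the depth of the strand being traversed. At a double point the strand
  with the smaller depth is the upper one.
\<close>

definition crossings :: "real \<Rightarrow> (real \<Rightarrow> complex) \<Rightarrow> complex set" where
  "crossings T \<gamma> = {z. \<exists>s t. 0 \<le> s \<and> s < t \<and> t < T \<and> \<gamma> s = z \<and> \<gamma> t = z}"

definition passes_over ::
  "real \<Rightarrow> (real \<Rightarrow> complex) \<Rightarrow> (real \<Rightarrow> 'a::linorder) \<Rightarrow> real \<Rightarrow> bool" where
  "passes_over T \<gamma> dep t \<longleftrightarrow>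
     (\<forall>t'. \<gamma> t' = \<gamma> t \<and> (\<nexists>n::int. t' = t + of_int n * T) \<longrightarrow> dep t < dep t')"

text \<open>
  In the next definition, \<open>num\<close> is the numbering of the crossings, \<open>t0\<close> the starting parameter,
  \<open>e\<close> the direction of travel, and \<open>ts\<close> lists the distances (in parameter) from the start at which
  crossings are met during one full turn.
\<close>

definition signed_gauss_code ::
  "real \<Rightarrow> (real \<Rightarrow> complex) \<Rightarrow> (real \<Rightarrow> 'a::linorder) \<Rightarrow> int list \<Rightarrow> bool" where
  "signed_gauss_code T \<gamma> dep C \<longleftrightarrow>
     (\<exists>(num :: complex \<Rightarrow> nat) t0 e ts.
        bij_betw num (crossings T \<gamma>) {1..card (crossings T \<gamma>)} \<and>
        \<gamma> t0 \<notin> crossings T \<gamma> \<and>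
        (e = 1 \<or> e = - 1) \<and>
        sorted_wrt (<) ts \<and>
        set ts = {s. 0 < s \<and> s < T \<and> \<gamma> (t0 + e * s) \<in> crossings T \<gamma>} \<and>
        C = map (\<lambda>s. if passes_over T \<gamma> dep (t0 + e * s)
                     then int (num (\<gamma> (t0 + e * s)))
                     else - int (num (\<gamma> (t0 + e * s)))) ts)"

definition petal_vertex :: "nat \<Rightarrow> int \<Rightarrow> complex" where
  "petal_vertex p i = cis (2 * pi * of_int i / real p)"

text \<open>
  Strand \<open>j\<close> is traversed for parameters in \<open>{j..j+1}\<close>; the curve has period \<open>p\<close>.
\<close>

definition split_petal_curve :: "nat \<Rightarrow> real \<Rightarrow> complex" where
  "split_petal_curve p t =
     (let m = (int p - 1) div 2; j = \<lfloor>t\<rfloor>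
      in (1 - frac t) *\<^sub>R petal_vertex p (m * j) + frac t *\<^sub>R petal_vertex p (m * (j + 1)))"

definition split_petal_depth :: "nat \<Rightarrow> (nat \<Rightarrow> nat) \<Rightarrow> real \<Rightarrow> nat" where
  "split_petal_depth p h t = h (nat (\<lfloor>t\<rfloor> mod int p))"

definition petal_L :: "nat \<Rightarrow> nat \<Rightarrow> nat" where
  "petal_L p k = ([0..<(p - 3) div 2] @ rev [0..<(p - 3) div 2]) ! (k mod (p - 3))"

definition petal_a :: "nat \<Rightarrow> nat \<Rightarrow> nat" where
  "petal_a p k = (replicate ((p - 3) div 2) 0 @ [1..<(p - 3) div 2 + 1]) ! (k mod (p - 3))"

definition petal_n :: "nat \<Rightarrow> nat \<Rightarrow> nat" where
  "petal_n p k = ((p - 1) div 2 * (k div (p - 3)) + petal_a p k) mod p + 1"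

definition petal_unsigned_gauss_code :: "nat \<Rightarrow> nat list" where
  "petal_unsigned_gauss_code p = map (\<lambda>k. p * petal_L p k + petal_n p k) [0..<p * (p - 3)]"

definition petal_d :: "nat \<Rightarrow> nat \<Rightarrow> int" where
  "petal_d p k =
     (if k mod (p - 3) < (p - 3) div 2 then int p - 3 - 2 * int (k mod (p - 3))
      else int p - 5 - 2 * int (k mod (p - 3)))"

definition petal_b :: "nat \<Rightarrow> nat \<Rightarrow> nat" where
  "petal_b p k = k div (p - 3)"

definition petal_b' :: "nat \<Rightarrow> nat \<Rightarrow> nat" where
  "petal_b' p k = nat ((int (k div (p - 3)) + petal_d p k) mod int p)"

end

theory Submission imports Defs begin

text \<open>
  Write \<open>p = 2q + 3\<close>. In coordinates rotated so that strand \<open>j\<close> is the vertical segment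
  \<open>{\<rho> + i x | -\<sigma> \<le> x \<le> \<sigma>}\<close>, every other strand is \<open>j + 2e\<close> (mod \<open>p\<close>) for a unique
  \<open>e\<close> with \<open>0 < \<bar>e\<bar> \<le> q + 1\<close>, and arises from it by a rotation through \<open>-2\<pi>e/p\<close>. Both are
  tangent to the circle of radius \<open>\<rho>\<close>, so they meet at \<open>x = -\<rho> tan (\<pi>e/p)\<close> on the first and at
  \<open>-x\<close> on the second; \<open>\<bar>e\<bar> = q + 1\<close> gives the corners. Hence strand \<open>j\<close> meets the strands with
  \<open>e = q, \<dots>, 1, -1, \<dots>, -q\<close> in this order, which is what \<open>d = 2e\<close> lists. The unordered pair
  \<open>{(j, e), (j + 2e, -e)}\<close> is determined by \<open>\<bar>e\<bar>\<close> and by the strand of the pair with \<open>e > 0\<close>; the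
  first is encoded by \<open>L = q - \<bar>e\<bar>\<close>, the second by \<open>n\<close>, since \<open>-2\<close> inverts \<open>(p - 1)/2\<close> mod \<open>p\<close>.
\<close>

section \<open>Angles and parameters of the star polygon\<close>

locale split_petal =
  fixes p q :: nat
  assumes p_eq: "p = 2 * q + 3" and q_pos: "0 < q"
begin

text \<open>Half the angle that a strand subtends at the centre: its ends are \<open>q + 1\<close>
  vertices apart. In the notation above, \<open>tan half_angle\<close> is \<sigma> / \<rho>.\<close>

definition half_angle :: real where
  "half_angle = pi * real (q + 1) / real p"

text \<open>The argument of the midpoint of strand \<open>j\<close>, not reduced modulo a full turn.
  Rotating by it carries the vertical model segment to strand \<open>j\<close>.\<close>

definition strand_angle :: "int \<Rightarrow> real" where
  "strand_angle j = pi * real (q + 1) * (2 * of_int j + 1) / real p"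

text \<open>The fraction \<open>u\<close> of a strand traversed when it meets the strand
  \<open>2 * e\<close> further on: the solution of \<sigma> (2u - 1) = - \<rho> tan (\<pi> e /
  p).\<close>

definition cross_pos :: "int \<Rightarrow> real" where
  "cross_pos e = (1 - tan (pi * of_int e / real p) / tan half_angle) / 2"

text \<open>The value of \<open>e\<close> at crossing number \<open>r\<close> of a strand, counted
  from 0. The second branch is lowered by one because \<open>e = 0\<close>, the strand itself, has
  to be skipped.\<close>

definition half_shift :: "nat \<Rightarrow> int" where
  "half_shift r = (if r < q then int q - int r else int q - 1 - int r)"

definition cross_time :: "nat \<Rightarrow> real" where
  "cross_time k = real (k div (2 * q)) + cross_pos (half_shift (k mod (2 * q)))"

section \<open>Positions of the crossings along one strand\<close>

lemma p_pos: "0 < p"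
  using p_eq by simp

lemma p_simps: "p - 3 = 2 * q" "(p - 3) div 2 = q" "(p - Suc 0) div 2 = Suc q"
  using p_eq by auto

lemma half_angle_bounds: "0 < half_angle" "half_angle < pi / 2"
proof -
  show "0 < half_angle" using p_pos by (simp add: half_angle_def add_pos_nonneg)
  show "half_angle < pi / 2" unfolding half_angle_def using p_eq by (simp add: field_simps)
qed

lemma tan_half_angle_pos: "0 < tan half_angle"
  using half_angle_bounds by (intro tan_gt_zero)

lemma shift_angle_less:
  assumes "\<bar>e\<bar> \<le> int q"
  shows "\<bar>pi * of_int e / real p\<bar> < half_angle"
proof -
  have "real_of_int \<bar>e\<bar> < real (q + 1)" using assms by linarith
  then have "pi * \<bar>of_int e\<bar> / real p < half_angle"
    unfolding half_angle_def using p_pos by (intro divide_strict_right_mono mult_strict_left_mono) auto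
  then show ?thesis by (simp add: abs_mult)
qed

text \<open>The angles involved stay within \<open>half_angle < pi / 2\<close> of 0, where
  \<open>tan\<close> increases; the minus sign in \<open>cross_pos\<close> reverses the
  order.\<close>

lemma cross_pos_strict_antimono:
  assumes "\<bar>e\<bar> \<le> int q" "\<bar>e'\<bar> \<le> int q" "e < e'"
  shows "cross_pos e' < cross_pos e"
proof -
  have "pi * of_int e / real p < pi * of_int e' / real p"
    using assms p_pos by (intro divide_strict_right_mono mult_strict_left_mono) auto
  then have "tan (pi * of_int e / real p) < tan (pi * of_int e' / real p)"
    using shift_angle_less[OF assms(1)] shift_angle_less[OF assms(2)] half_angle_bounds
    by (intro tan_monotone) linarith+
  then show ?thesis
    using tan_half_angle_pos by (simp add: cross_pos_def divide_strict_right_mono)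
qed

lemma cross_pos_inj:
  assumes "\<bar>e\<bar> \<le> int q" "\<bar>e'\<bar> \<le> int q" "cross_pos e = cross_pos e'"
  shows "e = e'"
  using cross_pos_strict_antimono[of e e'] cross_pos_strict_antimono[of e' e] assms
  by (metis less_irrefl linorder_neqE)

lemma cross_pos_bounds:
  assumes "\<bar>e\<bar> \<le> int q"
  shows "0 < cross_pos e" "cross_pos e < 1"
proof -
  let ?x = "pi * of_int e / real p"
  have "tan ?x < tan half_angle" "tan (- half_angle) < tan ?x"
    using shift_angle_less[OF assms] half_angle_bounds by (intro tan_monotone; linarith)+
  then show "0 < cross_pos e" "cross_pos e < 1"
    using tan_half_angle_pos by (auto simp: cross_pos_def field_simps)
qed

text \<open>Modulo \<open>p\<close>, the shifts \<open>2 * (q + 1)\<close> and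
  \<open>- 2 * (q + 1)\<close> are -1 and 1, so these are the corners shared with the preceding and
  the following strand.\<close>

lemma cross_pos_extreme: "cross_pos (int q + 1) = 0" "cross_pos (- (int q + 1)) = 1"
proof -
  have "pi * of_int (int q + 1) / real p = half_angle"
    by (simp add: half_angle_def add.commute)
  moreover from this have "pi * of_int (- (int q + 1)) / real p = - half_angle"
    by (simp only: of_int_minus mult_minus_right flip: minus_divide_left)
  ultimately show "cross_pos (int q + 1) = 0" "cross_pos (- (int q + 1)) = 1"
    using tan_half_angle_pos unfolding cross_pos_def by simp_all
qed

text \<open>As \<open>tan\<close> is odd, two crossing strands meet at mirror-image
  positions.\<close>

lemma cross_pos_minus: "cross_pos (- e) = 1 - cross_pos e"
  by (simp add: cross_pos_def field_simps)

lemma floor_frac_cross: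
  assumes "\<bar>e\<bar> \<le> int q"
  shows "\<lfloor>of_int j + cross_pos e\<rfloor> = j" "frac (of_int j + cross_pos e) = cross_pos e"
  using cross_pos_bounds[OF assms] by (auto simp: floor_unique frac_def)

section \<open>Rotated coordinates and the meeting of two strands\<close>

lemma curve_eq:
  assumes "0 \<le> u" "u < 1"
  shows "split_petal_curve p (of_int j + u) =
    cis (strand_angle j) * Complex (cos half_angle) (sin half_angle * (2 * u - 1))"
proof -
  have fl: "\<lfloor>of_int j + u\<rfloor> = j" "frac (of_int j + u) = u"
    using assms by (auto simp: floor_unique frac_def)
  have m: "(int p - 1) div 2 = int q + 1" using p_eq by simp
  \<comment> \<open>Both ends lie \<open>half_angle\<close> away from the direction of the midpoint,
    so the rotation \<open>cis (strand_angle j)\<close> factors out of the convex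
    combination.\<close>
  have v0: "petal_vertex p ((int q + 1) * j) = cis (strand_angle j) * cis (- half_angle)"
    by (simp add: petal_vertex_def strand_angle_def half_angle_def cis_mult algebra_simps
        flip: add_divide_distrib diff_divide_distrib)
  have v1: "petal_vertex p ((int q + 1) * (j + 1)) = cis (strand_angle j) * cis half_angle"
    by (simp add: petal_vertex_def strand_angle_def half_angle_def cis_mult algebra_simps
        flip: add_divide_distrib diff_divide_distrib)
  have "(1 - u) *\<^sub>R cis (- half_angle) + u *\<^sub>R cis half_angle
      = Complex (cos half_angle) (sin half_angle * (2 * u - 1))"
    by (simp add: complex_eq_iff algebra_simps)
  then show ?thesis
    unfolding split_petal_curve_def Let_def fl m v0 v1
    by (simp only: distrib_left[symmetric] mult_scaleR_right[symmetric])
qed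

lemma curve_periodic: "split_petal_curve p (t + of_int n * real p) = split_petal_curve p t"
proof -
  have per: "petal_vertex p (i + int p * a) = petal_vertex p i" for i a
  proof -
    have "2 * pi * of_int (i + int p * a) / real p = 2 * pi * of_int i / real p + 2 * pi * of_int a"
      using p_pos by (simp add: field_simps)
    moreover have "cis (2 * pi * of_int a) = 1"
      by (rule cis_multiple_2pi) simp
    ultimately show ?thesis
      by (simp add: petal_vertex_def flip: cis_mult)
  qed
  have fl: "\<lfloor>t + of_int n * real p\<rfloor> = \<lfloor>t\<rfloor> + n * int p"
    using floor_add_int[of t "n * int p"] by simp
  have fr: "frac (t + of_int n * real p) = frac t"
    using fl by (simp add: frac_def)
  have "m * (\<lfloor>t\<rfloor> + n * int p) = m * \<lfloor>t\<rfloor> + int p * (m * n)"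
    "m * (\<lfloor>t\<rfloor> + n * int p + 1) = m * (\<lfloor>t\<rfloor> + 1) + int p * (m * n)" for m :: int
    by (simp_all add: algebra_simps)
  then show ?thesis
    unfolding split_petal_curve_def Let_def fl fr by (simp only: per)
qed

text \<open>Since \<open>2 * (q + 1) = p - 1\<close>, advancing by \<open>2 * e\<close> strands
  turns by \<open>e\<close> full turns less 2 \<pi> e / p. This small residual angle is the reason
  for measuring shifts in steps of two.\<close>

lemma cis_strand_angle_shift:
  "cis (strand_angle (j + 2 * e)) = cis (strand_angle j) * cis (- 2 * (pi * of_int e / real p))"
proof -
  have "strand_angle (j + 2 * e) =
      strand_angle j + - 2 * (pi * of_int e / real p) + 2 * pi * of_int e"
    using p_pos by (simp add: strand_angle_def field_simps) (simp add: p_eq algebra_simps)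
  moreover have "cis (2 * pi * of_int e) = 1"
    by (rule cis_multiple_2pi) simp
  ultimately show ?thesis by (simp only: mult_1_right flip: cis_mult)
qed

text \<open>The half-open ranges of \<open>u\<close> and \<open>v\<close> remove the corners: for
  \<open>\<bar>e\<bar> = q + 1\<close> one of the two positions would have to be 1.\<close>

lemma strands_meet_iff:
  assumes e: "\<bar>e\<bar> \<le> int q + 1" and u: "0 \<le> u" "u < 1" and v: "0 \<le> v" "v < 1"
  shows "split_petal_curve p (of_int j + u) = split_petal_curve p (of_int (j + 2 * e) + v) \<longleftrightarrow>
    e = 0 \<and> u = v \<or> e \<noteq> 0 \<and> \<bar>e\<bar> \<le> int q \<and> u = cross_pos e \<and> v = cross_pos (- e)"
proof -
  define \<theta> where "\<theta> = pi * of_int e / real p"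
  define \<rho> where "\<rho> = cos half_angle"
  define \<sigma> where "\<sigma> = sin half_angle"
  define x where "x = \<sigma> * (2 * u - 1)"
  define y where "y = \<sigma> * (2 * v - 1)"
  have \<rho>: "\<rho> > 0" and \<sigma>: "\<sigma> > 0"
    unfolding \<rho>_def \<sigma>_def using half_angle_bounds by (auto intro: cos_gt_zero sin_gt_zero)
  have "\<bar>pi * of_int e / real p\<bar> \<le> half_angle"
  proof -
    have "real_of_int \<bar>e\<bar> \<le> real (q + 1)" using e by linarith
    then have "pi * \<bar>of_int e\<bar> / real p \<le> half_angle"
      unfolding half_angle_def by (intro divide_right_mono mult_left_mono) auto
    then show ?thesis by (simp add: abs_mult)
  qed
  then have \<theta>: "- (pi / 2) < \<theta>" "\<theta> < pi / 2"
    unfolding \<theta>_def using half_angle_bounds by linarith+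
  have cos\<theta>: "cos \<theta> > 0" using \<theta> by (intro cos_gt_zero_pi) auto
  have "split_petal_curve p (of_int j + u) = split_petal_curve p (of_int (j + 2 * e) + v) \<longleftrightarrow>
      Complex \<rho> x = cis (- 2 * \<theta>) * Complex \<rho> y"
    unfolding curve_eq[OF u] curve_eq[OF v] cis_strand_angle_shift
    by (simp add: \<theta>_def \<rho>_def \<sigma>_def x_def y_def mult.assoc)
  \<comment> \<open>Turning by \<theta> places the two strands symmetrically at angles \<theta> and
    -\<theta>. The terms \<rho> cos \<theta> then cancel in the real part, which leaves a product
    equal to zero.\<close>
  also have "\<dots> \<longleftrightarrow> cis \<theta> * Complex \<rho> x = cis \<theta> * (cis (- 2 * \<theta>) * Complex \<rho> y)"
    by simp
  also have "\<dots> \<longleftrightarrow> cis \<theta> * Complex \<rho> x = cis (- \<theta>) * Complex \<rho> y"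
    by (simp add: cis_mult flip: mult.assoc)
  also have "\<dots> \<longleftrightarrow> (x + y) * sin \<theta> = 0 \<and> 2 * \<rho> * sin \<theta> = (y - x) * cos \<theta>"
    by (auto simp: complex_eq_iff algebra_simps)
  also have "\<dots> \<longleftrightarrow> e = 0 \<and> u = v \<or> e \<noteq> 0 \<and> u = cross_pos e \<and> v = cross_pos (- e)"
  proof (cases "e = 0")
    case True
    then show ?thesis using \<sigma> by (auto simp: \<theta>_def x_def y_def)
  next
    case False
    have "\<theta> \<noteq> 0" using False p_pos by (simp add: \<theta>_def)
    then have sin\<theta>: "sin \<theta> \<noteq> 0"
      using \<theta> sin_eq_0_pi[of \<theta>] by auto
    have tan: "tan half_angle = \<sigma> / \<rho>" "tan \<theta> = sin \<theta> / cos \<theta>"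
      by (simp_all add: tan_def \<rho>_def \<sigma>_def)
    have cp: "cross_pos e = (1 - tan \<theta> / tan half_angle) / 2"
      by (simp add: cross_pos_def \<theta>_def)
    have xy: "x + y = 2 * \<sigma> * (u + v - 1)" "y - x = 2 * \<sigma> * (v - u)"
      by (simp_all add: x_def y_def algebra_simps)
    have "(x + y) * sin \<theta> = 0 \<longleftrightarrow> v = 1 - u"
      using sin\<theta> \<sigma> unfolding xy by auto
    \<comment> \<open>Here y = -x, so the equation reads x = - \<rho> tan \<theta>, which is the one
      that \<open>cross_pos\<close> solves.\<close>
    moreover have "2 * \<rho> * sin \<theta> = (y - x) * cos \<theta> \<longleftrightarrow> u = cross_pos e" if "v = 1 - u"
      unfolding xy that cp tan using \<rho> \<sigma> cos\<theta> by (auto simp: field_simps)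
    ultimately show ?thesis using False by (auto simp: cross_pos_minus)
  qed
  also have "\<dots> \<longleftrightarrow>
      e = 0 \<and> u = v \<or> e \<noteq> 0 \<and> \<bar>e\<bar> \<le> int q \<and> u = cross_pos e \<and> v = cross_pos (- e)"
  proof -
    have "\<bar>e\<bar> \<le> int q" if "u = cross_pos e" "v = cross_pos (- e)"
    proof (rule ccontr)
      assume "\<not> ?thesis"
      then have "e = int q + 1 \<or> e = - (int q + 1)" using e by linarith
      then show False using that u v cross_pos_extreme by fastforce
    qed
    then show ?thesis by blast
  qed
  finally show ?thesis .
qed

section \<open>Double points of the whole curve, modulo the period\<close>

lemma ex_half_shift:
  obtains e n where "\<bar>e\<bar> \<le> int q + 1" "i = j + 2 * e + n * int p"
proof -
  \<comment> \<open>As \<open>2 * (q + 2) = p + 1\<close>, the factor \<open>q + 2\<close> halves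
    modulo \<open>p\<close>. Adding \<open>q + 1\<close> before the reduction and subtracting it
    afterwards centres the residue at 0.\<close>
  define x where "x = (int q + 2) * (i - j) + int q + 1"
  define e where "e = x mod int p - (int q + 1)"
  have "0 \<le> x mod int p" "x mod int p < int p" using p_pos by auto
  then have "\<bar>e\<bar> \<le> int q + 1" using p_eq unfolding e_def by linarith
  moreover have "i = j + 2 * e + (2 * (x div int p) - (i - j)) * int p"
  proof -
    have "x mod int p = x - int p * (x div int p)"
      by (simp add: minus_mult_div_eq_mod)
    then show ?thesis
      unfolding e_def by (simp only: x_def[symmetric]) (simp add: x_def p_eq algebra_simps)
  qed
  ultimately show ?thesis using that by blast
qed

text \<open>The floors of the two parameters differ by \<open>2 * e + n * p\<close> with
  \<open>\<bar>e\<bar> \<le> q + 1\<close>; periodicity removes \<open>n\<close>, and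
  \<open>strands_meet_iff\<close> decides the rest.\<close>

lemma curve_meet_iff:
  "split_petal_curve p s = split_petal_curve p t \<longleftrightarrow>
    (\<exists>n::int. t = s + of_int n * real p) \<or>
    (\<exists>e n. e \<noteq> 0 \<and> \<bar>e\<bar> \<le> int q \<and> frac s = cross_pos e \<and>
       t = of_int (\<lfloor>s\<rfloor> + 2 * e) + cross_pos (- e) + of_int n * real p)" (is "?L \<longleftrightarrow> ?R")
proof
  have s: "s = of_int \<lfloor>s\<rfloor> + frac s" and t: "t = of_int \<lfloor>t\<rfloor> + frac t"
    by (simp_all add: frac_def)
  have fr: "0 \<le> frac s" "frac s < 1" "0 \<le> frac t" "frac t < 1"
    by (auto simp: frac_lt_1)
  {
    assume ?L
    obtain e n where e: "\<bar>e\<bar> \<le> int q + 1" and n: "\<lfloor>t\<rfloor> = \<lfloor>s\<rfloor> + 2 * e + n * int p"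
      using ex_half_shift by blast
    have t': "t = (of_int (\<lfloor>s\<rfloor> + 2 * e) + frac t) + of_int n * real p"
      using n by (simp add: frac_def)
    have "split_petal_curve p t = split_petal_curve p (of_int (\<lfloor>s\<rfloor> + 2 * e) + frac t)"
      by (subst t') (rule curve_periodic)
    then have "e = 0 \<and> frac s = frac t \<or>
        e \<noteq> 0 \<and> \<bar>e\<bar> \<le> int q \<and> frac s = cross_pos e \<and> frac t = cross_pos (- e)"
      using \<open>?L\<close> s strands_meet_iff[OF e fr, of "\<lfloor>s\<rfloor>"] by simp
    then show ?R
    proof
      assume "e = 0 \<and> frac s = frac t"
      then have "t = s + of_int n * real p" using t' s by simp
      then show ?R by blast
    next
      assume "e \<noteq> 0 \<and> \<bar>e\<bar> \<le> int q \<and> frac s = cross_pos e \<and> frac t = cross_pos (- e)"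
      then show ?R using t' by metis
    qed
  }
  {
    assume ?R
    then show ?L
    proof (elim disjE exE conjE)
      fix n :: int assume "t = s + of_int n * real p"
      then show ?L by (simp add: curve_periodic)
    next
      fix e n assume e: "e \<noteq> 0" "\<bar>e\<bar> \<le> int q" and fs: "frac s = cross_pos e"
        and t_eq: "t = of_int (\<lfloor>s\<rfloor> + 2 * e) + cross_pos (- e) + of_int n * real p"
      have b: "0 \<le> cross_pos (- e)" "cross_pos (- e) < 1"
        using cross_pos_bounds[of "- e"] e by auto
      have "split_petal_curve p s = split_petal_curve p (of_int (\<lfloor>s\<rfloor> + 2 * e) + cross_pos (- e))"
        using strands_meet_iff[of e "frac s" "cross_pos (- e)" "\<lfloor>s\<rfloor>"] e fs fr b s by simp
      then show ?L unfolding t_eq curve_periodic .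
    qed
  }
qed

text \<open>The fractional parts \<open>cross_pos (- e)\<close> and \<open>cross_pos e\<close>
  differ for \<open>e \<noteq> 0\<close>. Thus the two alternatives in \<open>curve_meet_iff\<close>
  exclude each other, and a crossing is really visited twice per period.\<close>

lemma cross_partner_not_congruent:
  assumes "e \<noteq> 0" "\<bar>e\<bar> \<le> int q" "frac s = cross_pos e"
  shows "of_int (\<lfloor>s\<rfloor> + 2 * e) + cross_pos (- e) + of_int n * real p \<noteq> s + of_int n' * real p"
proof
  assume "of_int (\<lfloor>s\<rfloor> + 2 * e) + cross_pos (- e) + of_int n * real p = s + of_int n' * real p"
  then have eq: "of_int (\<lfloor>s\<rfloor> + 2 * e + n * int p) + cross_pos (- e)
      = of_int (\<lfloor>s\<rfloor> + n' * int p) + cross_pos e"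
    using assms(3) by (simp add: frac_def)
  have "cross_pos (- e) = cross_pos e"
    using arg_cong[OF eq, of frac] floor_frac_cross(2) assms(2) by (metis abs_minus_cancel)
  then show False
    using cross_pos_inj[of "- e" e] assms by simp
qed

lemma real_mod_period:
  obtains n :: int where "0 \<le> t + of_int n * real p" "t + of_int n * real p < real p"
proof
  define n where "n = - \<lfloor>t / real p\<rfloor>"
  have "of_int (- n) \<le> t / real p" "t / real p < of_int (- n) + 1"
    unfolding n_def by linarith+
  then show "0 \<le> t + of_int n * real p" "t + of_int n * real p < real p"
    using p_pos by (simp_all add: field_simps)
qed

lemma congruent_in_period:
  assumes "0 \<le> s" "s < real p" "0 \<le> t" "t < real p" "t = s + of_int n * real p"
  shows "s = t"
proof -
  have "of_int n * real p < 1 * real p" "(- 1) * real p < of_int n * real p"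
    using assms by linarith+
  then have "of_int n < (1::real)" "- 1 < real_of_int n"
    using p_pos by (simp_all only: mult_less_cancel_right_pos of_nat_0_less_iff)
  then have "n = 0" by linarith
  then show ?thesis using assms by simp
qed

lemma crossingsI:
  assumes "0 \<le> a" "a < T" "0 \<le> b" "b < T" "a \<noteq> b" "\<gamma> a = z" "\<gamma> b = z"
  shows "z \<in> crossings T \<gamma>"
  using assms by (cases a b rule: linorder_cases) (auto simp: crossings_def)

text \<open>Two distinct parameters of one period cannot both be congruent to \<open>s\<close>, so a
  crossing forces the second alternative of \<open>curve_meet_iff\<close>. Conversely,
  \<open>s\<close> and its partner, each moved into the period, are two distinct visits.\<close>

lemma in_crossings_iff:
  "split_petal_curve p s \<in> crossings (real p) (split_petal_curve p) \<longleftrightarrow>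
    (\<exists>e. e \<noteq> 0 \<and> \<bar>e\<bar> \<le> int q \<and> frac s = cross_pos e)"
proof
  assume "split_petal_curve p s \<in> crossings (real p) (split_petal_curve p)"
  then obtain a b where ab: "0 \<le> a" "a < b" "b < real p"
    and eq: "split_petal_curve p s = split_petal_curve p a" "split_petal_curve p s = split_petal_curve p b"
    by (auto simp: crossings_def)
  show "\<exists>e. e \<noteq> 0 \<and> \<bar>e\<bar> \<le> int q \<and> frac s = cross_pos e"
  proof (rule ccontr)
    assume "\<not> ?thesis"
    then obtain n n' :: int where "a = s + of_int n * real p" "b = s + of_int n' * real p"
      using eq curve_meet_iff by meson
    then have eq: "b = a + of_int (n' - n) * real p" by (simp add: algebra_simps)
    have "a = b" by (rule congruent_in_period[OF _ _ _ _ eq]) (use ab in linarith)+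
    then show False using ab by simp
  qed
next
  assume "\<exists>e. e \<noteq> 0 \<and> \<bar>e\<bar> \<le> int q \<and> frac s = cross_pos e"
  then obtain e where e: "e \<noteq> 0" "\<bar>e\<bar> \<le> int q" "frac s = cross_pos e" by blast
  define t where "t = of_int (\<lfloor>s\<rfloor> + 2 * e) + cross_pos (- e)"
  obtain a :: int where a: "0 \<le> s + of_int a * real p" "s + of_int a * real p < real p"
    by (rule real_mod_period)
  obtain b :: int where b: "0 \<le> t + of_int b * real p" "t + of_int b * real p < real p"
    by (rule real_mod_period)
  have "split_petal_curve p s = split_petal_curve p (t + of_int b * real p)"
    unfolding curve_meet_iff t_def using e by blast
  moreover have "split_petal_curve p s = split_petal_curve p (s + of_int a * real p)"
    by (simp add: curve_periodic)
  moreover have "s + of_int a * real p \<noteq> t + of_int b * real p"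
    using cross_partner_not_congruent[OF e] unfolding t_def by metis
  ultimately show "split_petal_curve p s \<in> crossings (real p) (split_petal_curve p)"
    using crossingsI[where \<gamma> = "split_petal_curve p", OF a b] by simp
qed

section \<open>The crossings in order of travel\<close>

lemma half_shift_bounds:
  assumes "r < 2 * q"
  shows "half_shift r \<noteq> 0" "\<bar>half_shift r\<bar> \<le> int q"
  using assms by (auto simp: half_shift_def)

lemma half_shift_strict_antimono: "r < r' \<Longrightarrow> half_shift r' < half_shift r"
  by (auto simp: half_shift_def)

lemma ex_half_shift_index:
  assumes "e \<noteq> 0" "\<bar>e\<bar> \<le> int q"
  obtains r where "r < 2 * q" "half_shift r = e"
proof (cases "0 < e")
  case True
  define r where "r = nat (int q - e)"
  have "int r = int q - e" using assms by (simp add: r_def)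
  then show ?thesis using that[of r] True by (auto simp: half_shift_def)
next
  case False
  define r where "r = nat (int q - 1 - e)"
  have "int r = int q - 1 - e" using assms False by (simp add: r_def)
  then show ?thesis using that[of r] assms False by (auto simp: half_shift_def)
qed

lemma half_shift_index: "half_shift (k mod (2 * q)) \<noteq> 0" "\<bar>half_shift (k mod (2 * q))\<bar> \<le> int q"
  using half_shift_bounds[of "k mod (2 * q)"] q_pos by auto

lemma floor_frac_cross_time:
  "\<lfloor>cross_time k\<rfloor> = int (k div (2 * q))"
  "frac (cross_time k) = cross_pos (half_shift (k mod (2 * q)))"
  using floor_frac_cross[OF half_shift_index(2), of "int (k div (2 * q))" k]
  by (simp_all add: cross_time_def)

text \<open>Between strands the floor grows; on one strand \<open>half_shift\<close> and
  \<open>cross_pos\<close> are both decreasing, so their composition increases.\<close>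

lemma cross_time_strict_mono: "k < l \<Longrightarrow> cross_time k < cross_time l"
proof -
  assume "k < l"
  then have "k div (2 * q) \<le> l div (2 * q)" by (simp add: div_le_mono)
  then consider "k div (2 * q) < l div (2 * q)" | "k div (2 * q) = l div (2 * q)" by linarith
  then show ?thesis
  proof cases
    case 1
    then have "\<lfloor>cross_time k\<rfloor> < \<lfloor>cross_time l\<rfloor>" by (simp add: floor_frac_cross_time)
    then show ?thesis by (rule floor_less_cancel)
  next
    case 2
    then have "k mod (2 * q) < l mod (2 * q)"
      using \<open>k < l\<close> by (metis add_less_cancel_left div_mult_mod_eq)
    then have "cross_pos (half_shift (k mod (2 * q))) < cross_pos (half_shift (l mod (2 * q)))"
      by (intro cross_pos_strict_antimono half_shift_index half_shift_strict_antimono)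
    then show ?thesis using 2 by (simp add: cross_time_def)
  qed
qed

lemma cross_time_image:
  "cross_time ` {0..<p * (2 * q)} =
    {s. 0 < s \<and> s < real p \<and> split_petal_curve p s \<in> crossings (real p) (split_petal_curve p)}"
proof (intro equalityI subsetI)
  fix s assume "s \<in> cross_time ` {0..<p * (2 * q)}"
  then obtain k where k: "k < p * (2 * q)" "s = cross_time k" by auto
  then have "k div (2 * q) < p" by (simp add: less_mult_imp_div_less)
  then have "real (k div (2 * q)) + 1 \<le> real p" by linarith
  with k(2) have "0 < s" "s < real p"
    using cross_pos_bounds[OF half_shift_index(2), of k]
      of_nat_0_le_iff[of "k div (2 * q)", where 'a = real]
    unfolding cross_time_def by linarith+
  moreover have "split_petal_curve p s \<in> crossings (real p) (split_petal_curve p)"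
    unfolding in_crossings_iff k(2) floor_frac_cross_time using half_shift_index by blast
  ultimately show "s \<in> {s. 0 < s \<and> s < real p \<and>
      split_petal_curve p s \<in> crossings (real p) (split_petal_curve p)}" by simp
next
  fix s assume "s \<in> {s. 0 < s \<and> s < real p \<and>
      split_petal_curve p s \<in> crossings (real p) (split_petal_curve p)}"
  then obtain e where s: "0 < s" "s < real p"
    and e: "e \<noteq> 0" "\<bar>e\<bar> \<le> int q" "frac s = cross_pos e"
    by (auto simp: in_crossings_iff)
  obtain r where r: "r < 2 * q" "half_shift r = e" using ex_half_shift_index[OF e(1,2)] .
  define j where "j = nat \<lfloor>s\<rfloor>"
  have j: "j < p" "real j = of_int \<lfloor>s\<rfloor>"
    using s by (auto simp: j_def nat_less_iff floor_less_iff)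
  have "cross_time (j * (2 * q) + r) = s"
    using r j(2) e(3) by (simp add: cross_time_def frac_def)
  moreover have "j * (2 * q) + r < p * (2 * q)"
  proof -
    have "j * (2 * q) + r < Suc j * (2 * q)" using r by simp
    also have "\<dots> \<le> p * (2 * q)" using j(1) by (intro mult_le_mono1) simp
    finally show ?thesis .
  qed
  ultimately show "s \<in> cross_time ` {0..<p * (2 * q)}"
    by (metis atLeastLessThan_iff imageI zero_le)
qed

text \<open>Parameter 0 is a corner, whereas every \<open>cross_pos e\<close> in question is
  strictly positive.\<close>

lemma start_not_crossing:
  "split_petal_curve p 0 \<notin> crossings (real p) (split_petal_curve p)"
  unfolding in_crossings_iff using cross_pos_bounds by fastforce

lemma crossings_eq:
  "crossings (real p) (split_petal_curve p) =
    (\<lambda>k. split_petal_curve p (cross_time k)) ` {0..<p * (2 * q)}"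
proof (intro equalityI subsetI)
  fix z assume z: "z \<in> crossings (real p) (split_petal_curve p)"
  then obtain s where s: "0 \<le> s" "s < real p" "z = split_petal_curve p s"
    by (auto simp: crossings_def)
  \<comment> \<open>\<open>crossings\<close> admits the parameter 0, which
    \<open>cross_time_image\<close> leaves out.\<close>
  then have "s \<noteq> 0" using z start_not_crossing by metis
  then have "s \<in> cross_time ` {0..<p * (2 * q)}" using s z by (auto simp: cross_time_image)
  then show "z \<in> (\<lambda>k. split_petal_curve p (cross_time k)) ` {0..<p * (2 * q)}"
    using s(3) by auto
next
  fix z assume "z \<in> (\<lambda>k. split_petal_curve p (cross_time k)) ` {0..<p * (2 * q)}"
  then show "z \<in> crossings (real p) (split_petal_curve p)"
    using cross_time_image by auto
qed

section \<open>Arithmetic of the petal unsigned Gauss code\<close>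

lemma petal_d_eq: "petal_d p k = 2 * half_shift (k mod (2 * q))"
  using p_eq by (simp add: petal_d_def half_shift_def p_simps)

text \<open>Crossings with equal \<open>\<bar>e\<bar>\<close> lie on one circle about the centre;
  \<open>petal_L\<close> numbers these circles from the outermost inwards.\<close>

lemma petal_L_eq: "int (petal_L p k) = int q - \<bar>half_shift (k mod (2 * q))\<bar>"
proof -
  have "k mod (2 * q) < 2 * q" using q_pos by simp
  then show ?thesis
    by (auto simp: petal_L_def half_shift_def p_simps nth_append rev_nth)
qed

text \<open>Modulo \<open>p\<close>, \<open>(q + 1) * (j + 2 * e)\<close> is
  \<open>(q + 1) * j - e\<close>. So the summand \<open>petal_a\<close> replaces strand
  \<open>j\<close> by its partner exactly when \<open>e < 0\<close>.\<close>

lemma petal_a_eq: "int (petal_a p k) = max 0 (- half_shift (k mod (2 * q)))"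
proof -
  have "k mod (2 * q) < 2 * q" using q_pos by simp
  moreover have "[1..<q + 1] ! (x - q) = 1 + (x - q)" if "q \<le> x" "x < 2 * q" for x
    using that by (subst nth_upt) auto
  ultimately show ?thesis
    by (auto simp: petal_a_def half_shift_def p_simps nth_append)
qed

definition code :: "nat \<Rightarrow> nat" where
  "code k = p * petal_L p k + petal_n p k"

text \<open>The number \<open>j + 2 * min 0 e\<close> names the strand of the crossing pair whose
  half shift is positive, and \<open>petal_n - 1\<close> is \<open>q + 1\<close> times it modulo
  \<open>p\<close>. This loses nothing because \<open>q + 1\<close> is invertible.\<close>

lemma petal_n_cong_iff:
  "petal_n p k = petal_n p l \<longleftrightarrow>
    (int (k div (2 * q)) + 2 * min 0 (half_shift (k mod (2 * q)))) mod int p =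
    (int (l div (2 * q)) + 2 * min 0 (half_shift (l mod (2 * q)))) mod int p"
proof -
  define x where "x k = int (q + 1) * int (k div (2 * q)) + max 0 (- half_shift (k mod (2 * q)))" for k
  define y where "y k = int (k div (2 * q)) + 2 * min 0 (half_shift (k mod (2 * q)))" for k
  have n: "int (petal_n p k) = x k mod int p + 1" for k
    by (simp add: petal_n_def x_def zmod_int petal_a_eq p_simps algebra_simps)
  \<comment> \<open>This identity and the next one say that y is congruent to -2x and x to (q + 1)
    y, so differences of either kind are divisible by \<open>p\<close> together.\<close>
  have y: "y k = int (k div (2 * q)) * int p - 2 * x k" for k
    by (simp add: x_def y_def p_eq algebra_simps min_def max_def)
  have x: "x k = (x k - int (k div (2 * q)) * (int q + 1)) * int p + (int q + 1) * y k" for k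
    unfolding y p_eq by (simp add: algebra_simps)
  have "petal_n p k = petal_n p l \<longleftrightarrow> x k mod int p = x l mod int p"
    using n by (metis add_right_cancel of_nat_eq_iff)
  also have "\<dots> \<longleftrightarrow> int p dvd x k - x l"
    by (simp add: mod_eq_dvd_iff)
  also have "\<dots> \<longleftrightarrow> int p dvd y k - y l"
  proof
    assume "int p dvd x k - x l"
    moreover have "y k - y l
        = (int (k div (2 * q)) - int (l div (2 * q))) * int p - 2 * (x k - x l)"
      unfolding y by (simp add: algebra_simps)
    ultimately show "int p dvd y k - y l" by (simp only: dvd_diff dvd_triv_right dvd_mult)
  next
    assume "int p dvd y k - y l"
    moreover obtain a where "x k - x l = a * int p + (int q + 1) * (y k - y l)"
    proof
      show "x k - x l = ((x k - int (k div (2 * q)) * (int q + 1)) -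
          (x l - int (l div (2 * q)) * (int q + 1))) * int p + (int q + 1) * (y k - y l)"
        using x[of k] x[of l] by (simp add: algebra_simps)
    qed
    ultimately show "int p dvd x k - x l" by (simp only: dvd_add dvd_triv_right dvd_mult)
  qed
  also have "\<dots> \<longleftrightarrow> y k mod int p = y l mod int p"
    by (simp add: mod_eq_dvd_iff)
  finally show ?thesis unfolding y_def .
qed

lemma petal_n_bounds: "1 \<le> petal_n p k" "petal_n p k \<le> p"
  using p_pos by (auto simp: petal_n_def Suc_leI)

text \<open>Because \<open>petal_n\<close> ranges over 1 to \<open>p\<close>, it is
  \<open>code k - 1\<close> that has quotient \<open>petal_L p k\<close> and remainder
  \<open>petal_n p k - 1\<close> on division by \<open>p\<close>.\<close>

lemma code_eq_iff: "code k = code l \<longleftrightarrow> petal_L p k = petal_L p l \<and> petal_n p k = petal_n p l"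
proof
  assume "code k = code l"
  then have eq: "p * petal_L p k + (petal_n p k - 1) = p * petal_L p l + (petal_n p l - 1)"
    using petal_n_bounds(1)[of k] petal_n_bounds(1)[of l] unfolding code_def by linarith
  have lt: "petal_n p k - 1 < p" "petal_n p l - 1 < p"
    using petal_n_bounds[of k] petal_n_bounds[of l] by linarith+
  have "petal_L p k = petal_L p l"
    using arg_cong[OF eq, of "\<lambda>x. x div p"] lt p_pos by simp
  moreover have "petal_n p k - 1 = petal_n p l - 1"
    using eq calculation by simp
  ultimately show "petal_L p k = petal_L p l \<and> petal_n p k = petal_n p l"
    using petal_n_bounds(1)[of k] petal_n_bounds(1)[of l] by linarith
qed (simp add: code_def)

section \<open>Labels agree exactly at equal crossings\<close>

lemma cross_time_meet_iff:
  assumes "k < p * (2 * q)" "l < p * (2 * q)"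
  shows "split_petal_curve p (cross_time k) = split_petal_curve p (cross_time l) \<longleftrightarrow> code k = code l"
proof -
  define j e j' e' where "j = int (k div (2 * q))" and "e = half_shift (k mod (2 * q))"
    and "j' = int (l div (2 * q))" and "e' = half_shift (l mod (2 * q))"
  note defs = j_def e_def j'_def e'_def
  have e: "e \<noteq> 0" "\<bar>e\<bar> \<le> int q" "e' \<noteq> 0" "\<bar>e'\<bar> \<le> int q"
    unfolding defs using half_shift_index by auto
  have "k div (2 * q) < p" "l div (2 * q) < p"
    using assms by (simp_all add: less_mult_imp_div_less)
  then have j: "j mod int p = j" "j' mod int p = j'"
    unfolding defs by simp_all
  have t: "cross_time k = of_int j + cross_pos e" "cross_time l = of_int j' + cross_pos e'"
    by (simp_all add: cross_time_def defs)
  have fl: "\<lfloor>cross_time k\<rfloor> = j" "frac (cross_time k) = cross_pos e"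
    by (simp_all add: floor_frac_cross_time defs)
  have eq_iff: "of_int a + cross_pos e' = of_int b + cross_pos f \<longleftrightarrow> a = b \<and> e' = f"
    if "\<bar>f\<bar> \<le> int q" for a b f
    using floor_frac_cross[OF e(4), of a] floor_frac_cross[OF that, of b] cross_pos_inj[OF e(4) that]
    by metis
  have c1: "cross_time l = cross_time k + of_int n * real p \<longleftrightarrow> j' = j + n * int p \<and> e' = e" for n
    using eq_iff[OF e(2), of j' "j + n * int p"] unfolding t by (simp add: algebra_simps)
  have c2: "cross_time l = of_int (j + 2 * f) + cross_pos (- f) + of_int n * real p \<longleftrightarrow>
      j' = j + 2 * f + n * int p \<and> e' = - f" if "\<bar>f\<bar> \<le> int q" for f n
    using eq_iff[of "- f" j' "j + 2 * f + n * int p"] that unfolding t by (simp add: algebra_simps)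
  have cong: "(\<exists>n. j' = a + n * int p) \<longleftrightarrow> j' mod int p = a mod int p" for a
    by (metis mod_mult_self1 mod_eq_dvd_iff dvd_def add.commute diff_add_cancel mult.commute)
  have "split_petal_curve p (cross_time k) = split_petal_curve p (cross_time l) \<longleftrightarrow>
      (\<exists>n. j' = j + n * int p) \<and> e' = e \<or> (\<exists>n. j' = j + 2 * e + n * int p) \<and> e' = - e"
    unfolding curve_meet_iff fl c1
    using c2 e(1,2) cross_pos_inj[OF e(2)] by (metis (no_types, lifting))
  also have "\<dots> \<longleftrightarrow> j' mod int p = j mod int p \<and> e' = e \<or>
      j' mod int p = (j + 2 * e) mod int p \<and> e' = - e"
    unfolding cong ..
  \<comment> \<open>The relation of being equal or partners is turned into equality of a normal
    form. For \<open>e' = - e\<close> exactly one of the two half shifts is negative, so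
    \<open>min\<close> moves only one of the strands.\<close>
  also have "\<dots> \<longleftrightarrow> \<bar>e\<bar> = \<bar>e'\<bar> \<and> (j + 2 * min 0 e) mod int p = (j' + 2 * min 0 e') mod int p"
  proof -
    consider "e' = e" | "e' = - e" | "\<bar>e\<bar> \<noteq> \<bar>e'\<bar>" by linarith
    then show ?thesis
    proof cases
      case 1
      then show ?thesis using e(1) by (auto simp: mod_eq_dvd_iff dvd_diff_commute)
    next
      case 2
      then show ?thesis
        using e(1) by (cases "0 < e") (auto simp: mod_eq_dvd_iff dvd_diff_commute algebra_simps)
    next
      case 3
      then show ?thesis by auto
    qed
  qed
  also have "\<dots> \<longleftrightarrow> code k = code l"
    unfolding code_eq_iff petal_n_cong_iff
    using petal_L_eq[of k] petal_L_eq[of l] by (auto simp: defs)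
  finally show ?thesis .
qed

lemma code_image: "code ` {0..<p * (2 * q)} = {1..p * q}"
proof (intro equalityI subsetI)
  fix N assume "N \<in> code ` {0..<p * (2 * q)}"
  then obtain k where N: "N = p * petal_L p k + petal_n p k" by (auto simp: code_def)
  have "petal_L p k + 1 \<le> q" using petal_L_eq[of k] half_shift_index[of k] by linarith
  then have "p * (petal_L p k + 1) \<le> p * q" by (rule mult_le_mono2)
  then show "N \<in> {1..p * q}" using N petal_n_bounds[of k] by simp
next
  fix N assume N: "N \<in> {1..p * q}"
  \<comment> \<open>The preimage is sought among the crossings with \<open>e > 0\<close>: there
    position \<open>r < q\<close> gives \<open>petal_L = r\<close> and \<open>petal_a = 0\<close>,
    and \<open>j\<close> must solve (q + 1) j = n modulo \<open>p\<close>, hence j = -2n.\<close>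
  define r n where "r = (N - 1) div p" and "n = (N - 1) mod p"
  define j where "j = nat ((- 2 * int n) mod int p)"
  have r: "r < q"
    unfolding r_def using N by (intro less_mult_imp_div_less) (auto simp: mult.commute)
  have n: "n < p" unfolding n_def using p_pos by simp
  have int_j: "int j = (- 2 * int n) mod int p" and j: "j < p"
    using p_pos by (simp_all add: j_def nat_less_iff)
  define k where "k = j * (2 * q) + r"
  have k: "k div (2 * q) = j" "k mod (2 * q) = r" using r by (simp_all add: k_def)
  have "k < Suc j * (2 * q)" using r by (simp add: k_def)
  also have "\<dots> \<le> p * (2 * q)" using j by (intro mult_le_mono1) simp
  finally have "k \<in> {0..<p * (2 * q)}" by simp
  moreover have "code k = N"
  proof -
    have L: "petal_L p k = r"
      using petal_L_eq[of k] r by (simp add: k half_shift_def)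
    have a: "petal_a p k = 0"
      using petal_a_eq[of k] r by (simp add: k half_shift_def)
    have "int (((q + 1) * j) mod p) = ((int q + 1) * (- 2 * int n)) mod int p"
      by (simp only: zmod_int of_nat_mult of_nat_add of_nat_1 int_j mod_mult_right_eq)
    also have "(int q + 1) * (- 2 * int n) = int n + (- int n) * int p"
      by (simp add: p_eq algebra_simps)
    also have "\<dots> mod int p = int n"
      using n by (subst mod_mult_self1) simp
    finally have "petal_n p k = n + 1"
      by (simp add: petal_n_def a k p_simps)
    then show ?thesis
      using N by (simp add: code_def L r_def n_def)
  qed
  ultimately show "N \<in> code ` {0..<p * (2 * q)}" by blast
qed

section \<open>Over and under passages\<close>

lemma passes_over_cross_time_iff:
  assumes "k < p * (2 * q)"
  shows "passes_over (real p) (split_petal_curve p) (split_petal_depth p h) (cross_time k) \<longleftrightarrow>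
    h (petal_b p k) < h (petal_b' p k)"
proof -
  define e where "e = half_shift (k mod (2 * q))"
  have e: "e \<noteq> 0" "\<bar>e\<bar> \<le> int q" unfolding e_def using half_shift_index by auto
  let ?s = "cross_time k"
  have fl: "\<lfloor>?s\<rfloor> = int (k div (2 * q))" "frac ?s = cross_pos e"
    by (simp_all add: floor_frac_cross_time e_def)
  have "k div (2 * q) < p" using assms by (simp add: less_mult_imp_div_less)
  then have dep: "split_petal_depth p h ?s = h (petal_b p k)"
    by (simp add: split_petal_depth_def fl petal_b_def p_simps)
  define t where "t n = of_int (\<lfloor>?s\<rfloor> + 2 * e) + cross_pos (- e) + of_int n * real p" for n
  have dep': "split_petal_depth p h (t n) = h (petal_b' p k)" for n
  proof -
    have t_eq: "t n = of_int (\<lfloor>?s\<rfloor> + 2 * e + n * int p) + cross_pos (- e)" by (simp add: t_def)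
    have "\<lfloor>t n\<rfloor> = \<lfloor>?s\<rfloor> + 2 * e + n * int p"
      unfolding t_eq by (rule floor_frac_cross) (use e in simp)
    then show ?thesis
      by (simp add: split_petal_depth_def fl petal_b'_def petal_d_eq e_def p_simps)
  qed
  \<comment> \<open>All other visits are period translates of a single parameter inside strand
    \<open>petal_b' p k\<close>, so the quantifier in \<open>passes_over\<close> collapses to one
    comparison of depths.\<close>
  have partner: "split_petal_curve p t' = split_petal_curve p ?s \<and> (\<nexists>n::int. t' = ?s + of_int n * real p)
      \<longleftrightarrow> (\<exists>n. t' = t n)" for t'
  proof -
    have "split_petal_curve p t' = split_petal_curve p ?s \<longleftrightarrow>
        (\<exists>n::int. t' = ?s + of_int n * real p) \<or> (\<exists>n. t' = t n)"
      unfolding eq_commute[of "split_petal_curve p t'"] curve_meet_iff[of ?s t'] t_def fl(2)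
      using e cross_pos_inj[OF e(2)] by metis
    moreover have "t n \<noteq> ?s + of_int n' * real p" for n n'
      unfolding t_def by (rule cross_partner_not_congruent[OF e fl(2)])
    ultimately show ?thesis by metis
  qed
  show ?thesis
    unfolding passes_over_def partner dep using dep' by metis
qed

section \<open>Assembly of the signed Gauss code\<close>

theorem signed_gauss_code_split_petal:
  "signed_gauss_code (real p) (split_petal_curve p) (split_petal_depth p h)
     (map (\<lambda>k. if h (petal_b p k) < h (petal_b' p k) then int (code k) else - int (code k))
       [0..<p * (2 * q)])"
proof -
  let ?\<gamma> = "split_petal_curve p"
  let ?I = "{0..<p * (2 * q)}"
  \<comment> \<open>A crossing is labelled through either of its visits. One direction of
    \<open>cross_time_meet_iff\<close> makes the choice immaterial, the other makes the labelling
    injective.\<close>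
  define num where "num z = code (SOME k. k \<in> ?I \<and> ?\<gamma> (cross_time k) = z)" for z
  have num: "num (?\<gamma> (cross_time k)) = code k" if "k \<in> ?I" for k
  proof -
    define l where "l = (SOME l. l \<in> ?I \<and> ?\<gamma> (cross_time l) = ?\<gamma> (cross_time k))"
    have "l \<in> ?I \<and> ?\<gamma> (cross_time l) = ?\<gamma> (cross_time k)"
      unfolding l_def by (rule someI[of _ k]) (use that in simp)
    then have "code l = code k" using cross_time_meet_iff[of l k] that by simp
    then show ?thesis unfolding num_def l_def .
  qed
  have inj: "inj_on num (crossings (real p) ?\<gamma>)"
  proof (rule inj_onI)
    fix y z assume "y \<in> crossings (real p) ?\<gamma>" "z \<in> crossings (real p) ?\<gamma>" and eq: "num y = num z"
    then obtain k l where "k \<in> ?I" "l \<in> ?I" "y = ?\<gamma> (cross_time k)" "z = ?\<gamma> (cross_time l)"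
      unfolding crossings_eq by blast
    then show "y = z" using eq num cross_time_meet_iff[of k l] by simp
  qed
  have img: "num ` crossings (real p) ?\<gamma> = {1..p * q}"
    unfolding crossings_eq image_image code_image[symmetric] using num by (intro image_cong) auto
  have "card (crossings (real p) ?\<gamma>) = p * q"
    using card_image[OF inj] img by simp
  then have bij: "bij_betw num (crossings (real p) ?\<gamma>) {1..card (crossings (real p) ?\<gamma>)}"
    using inj img by (simp add: bij_betw_def)
  have sorted: "sorted_wrt (<) (map cross_time [0..<p * (2 * q)])"
    using cross_time_strict_mono by (auto simp: sorted_wrt_iff_nth_less)
  have codes: "map (\<lambda>k. if h (petal_b p k) < h (petal_b' p k) then int (code k) else - int (code k))
        [0..<p * (2 * q)] =
      map (\<lambda>s. if passes_over (real p) ?\<gamma> (split_petal_depth p h) (0 + 1 * s)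
          then int (num (?\<gamma> (0 + 1 * s))) else - int (num (?\<gamma> (0 + 1 * s))))
        (map cross_time [0..<p * (2 * q)])"
    by (simp add: passes_over_cross_time_iff num)
  show ?thesis
    unfolding signed_gauss_code_def
    \<comment> \<open>The journey starts at the corner with parameter 0 and runs in the direction of
      increasing parameter, so the distances travelled are the crossing times themselves.\<close>
    by (rule exI[of _ num], rule exI[of _ 0], rule exI[of _ 1],
        rule exI[of _ "map cross_time [0..<p * (2 * q)]"])
      (use bij start_not_crossing sorted cross_time_image codes in simp)
qed

end

theorem theorem7:
  fixes p :: nat and h :: "nat \<Rightarrow> nat"
  assumes "5 \<le> p" and "odd p"
    and "bij_betw h {0..<p} {1..p}"
  shows "signed_gauss_code (real p) (split_petal_curve p) (split_petal_depth p h)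
           (map (\<lambda>k. if h (petal_b p k) < h (petal_b' p k)
                     then int (petal_unsigned_gauss_code p ! k)
                     else - int (petal_unsigned_gauss_code p ! k))
                [0..<p * (p - 3)])"
proof -
  define q where "q = (p - 3) div 2"
  interpret split_petal p q
    using assms(1,2) by unfold_locales (auto simp: q_def elim!: oddE)
  have "map (\<lambda>k. if h (petal_b p k) < h (petal_b' p k)
                 then int (petal_unsigned_gauss_code p ! k)
                 else - int (petal_unsigned_gauss_code p ! k)) [0..<p * (p - 3)] =
      map (\<lambda>k. if h (petal_b p k) < h (petal_b' p k) then int (code k) else - int (code k))
        [0..<p * (2 * q)]"
    by (intro map_cong) (auto simp: petal_unsigned_gauss_code_def code_def p_simps)
  then show ?thesis
    using signed_gauss_code_split_petal by simp
qed

end
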